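(* Let $\delta,\kappa,\lambda>0$ and $\mu\ge 0$ be constants, $h(x)=\kappa x^2+\mu$ and $g(x)=\lambda x^2$. Suppose that $\delta\lambda-\kappa>0$ and $\sqrt{\frac{\kappa+\delta\mu}{\delta(\delta\lambda-\kappa)}}\ne\frac{\delta}{2\kappa}$. The equation $$\tanh\big(\sqrt{2\delta}\,\alpha\big)=\frac{\delta(\delta-2\kappa\alpha)}{\sqrt{2\delta}\,\big[\delta(\delta\lambda-\kappa)\alpha^2-(\kappa+\delta\mu)\big]}$$ has a unique solution $\alpha>0$ such that $$\text{(R1)}\quad\text{if }\ \frac{\delta}{2\kappa}<\sqrt{\frac{\kappa+\delta\mu}{\delta(\delta\lambda-\kappa)}},\ \text{ then }\ \frac1{2\lambda}<\frac{\delta}{2\kappa}<\alpha<\sqrt{\frac{\kappa+\delta\mu}{\delta(\delta\lambda-\kappa)}},$$ while $$\text{(R2)}\quad\text{if }\ \sqrt{\frac{\kappa+\delta\mu}{\delta(\delta\lambda-\kappa)}}<\frac{\delta}{2\kappa},\ \text{ then }\ \sqrt{\frac{\kappa+\delta\mu}{\delta(\delta\lambda-\kappa)}}<\alpha<\frac{\delta}{2\kappa}.$$ For this $\alpha$ let $$u(x)=\begin{cases}A\cosh(\sqrt{2\delta}\,x)+\dfrac{\kappa}{\delta}x^2+\dfrac{\kappa+\delta\mu}{\delta^2},&|x|\le\alpha,\\[4pt] |x|-\alpha+u(\alpha),&|x|>\alpha,\end{cases}\qquad A=\frac{\delta(\delta\lambda-\kappa)\alpha^2-(\kappa+\delta\mu)}{\delta^2\cosh(\sqrt{2\delta}\,\alpha)}.$$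 (1) If the parameters are such that the case (R1) holds, i.e. $\frac{\delta}{2\kappa}<\sqrt{\frac{\kappa+\delta\mu}{\delta(\delta\lambda-\kappa)}}$ (in which case $A<0$), then $u$ is a candidate for the value function (as defined in the context) if and only if $$\tanh\sqrt{\frac{2\delta\mu}{\delta\lambda-\kappa}}\ge\sqrt{\frac{2\delta\mu}{\delta\lambda-\kappa}}-\frac{\delta^2}{\kappa\sqrt{2\delta}}.$$ (2) If the parameters are such that the case (R2) holds, i.e. $\sqrt{\frac{\kappa+\delta\mu}{\delta(\delta\lambda-\kappa)}}<\frac{\delta}{2\kappa}$ (in which case $A>0$), then $\frac{1}{2\lambda}<\alpha$ if and only if either $$\frac1{2\lambda}\le\sqrt{\frac{\kappa+\delta\mu}{\delta(\delta\lambda-\kappa)}},$$ or $$\frac1{2\lambda}>\sqrt{\frac{\kappa+\delta\mu}{\delta(\delta\lambda-\kappa)}}\quad\text{and}\quad\tanh\frac{\sqrt{2\delta}}{2\lambda}<\frac{\sqrt{2\delta}\,(\delta\lambda-\kappa)\lambda}{\delta(\delta\lambda-\kappa)-4(\kappa+\delta\mu)\lambda^2},$$ in which case $u$ is a candidate for the value function.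
   Context: Candidate for the value function (for the data $b\equiv0$, $\sigma\equiv1$, constant discount rate $\delta$, running payoff $h(x)=\kappa x^2+\mu$, terminal payoff $g(x)=\lambda x^2$). Let $\mathcal{L}u(x)=\frac12u''(x)-\delta u(x)$. A candidate is a continuous $u:\mathbb{R}\to\mathbb{R}_+$ that is $C^1$ with absolutely continuous first derivative inside $\mathbb{R}\setminus\mathcal{B}$, where $\mathcal{B}$ is a finite set, that satisfies $|u'(x)|\le 1$ for all $x\in\mathbb{R}\setminus\mathcal{B}$, and that has properties (i)–(iii) below, where $\mathcal{C}=\mathrm{cl}\big[\mathrm{int}\{x\in\mathbb{R}\setminus\mathcal{B}: |u'(x)|=1\}\big]$, $\mathcal{S}_{\mathcal W}=\{x\in\mathbb{R}: u(x)=g(x)\}$, $\mathcal{S}_{\mathcal C}=\mathrm{cl}\{x\in\mathbb{R}: u(x)<g(x)\}$, $\mathcal{S}=\mathcal{S}_{\mathcal W}\cup\mathcal{S}_{\mathcal C}$, $\mathcal{W}=\mathbb{R}\setminus(\mathcal{C}\cup\mathcal{S})$ (int and cl denote interior and closure): (i) each of $\mathcal{C},\mathcal{S}_{\mathcal W},\mathcal{S}_{\mathcal C}$ is a finite union of intervals, and $\mathcal{B}\subseteq\mathcal{S}_{\mathcal C}\subseteq\mathcal{C}$; (ii) $\mathcal{L}u+h=0$ Lebesgue-a.e. in $\mathcal{W}$; $\mathcal{L}u+h\ge0$ Lebesgue-a.e. in $\mathrm{int}(\mathcal{C}\setminus\mathcal{S})$; $\mathcal{L}u+h=\mathcal{L}g+h\le0$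 Lebesgue-a.e. in $\mathrm{int}\,\mathcal{S}_{\mathcal W}$; and $\mathcal{L}u+h\in\mathbb{R}$ (no sign condition) Lebesgue-a.e. in $\mathrm{int}\,\mathcal{S}_{\mathcal C}\setminus\mathcal{B}$; (iii) for every $c\in\mathcal{B}$, with $u'_-(c)$, $u'_+(c)$ the left-hand and right-hand derivatives of $u$ at $c$, either $u'_-(c)=1$ and $u'_+(c)<1$, or $u'_-(c)>-1$ and $u'_+(c)=-1$.
   Formalization: In part (2) the numerator of the last bound is 2√(2δ)(δλ−κ)λ rather than √(2δ)(δλ−κ)λ; as printed, the "only if" fails, e.g. for δ=2, κ=1/10, λ=1/2, μ=0, where 1/(2λ)=1<α but tanh 2 > 9/17. *)

theory Defs
  imports "HOL-Analysis.Analysis"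
begin

text \<open>Absolute continuity of a function on a compact interval (the epsilon-delta notion; the
  library's \<open>absolutely_continuous\<close> is the relation between measures).\<close>

definition abs_cont_on_interval :: "(real \<Rightarrow> real) \<Rightarrow> real \<Rightarrow> real \<Rightarrow> bool" where
  "abs_cont_on_interval f a b \<longleftrightarrow>
     (\<forall>\<epsilon>>0. \<exists>\<eta>>0. \<forall>P :: (real \<times> real) set.
        finite P \<and> (\<forall>(s, t)\<in>P. a \<le> s \<and> s \<le> t \<and> t \<le> b) \<and>
        disjoint_family_on (\<lambda>(s, t). {s<..<t}) P \<and> (\<Sum>(s, t)\<in>P. t - s) < \<eta>
        \<longrightarrow> (\<Sum>(s, t)\<in>P. \<bar>f t - f s\<bar>) < \<epsilon>)"

text \<open>On an open set, absolute continuity is required on every compact subinterval.\<close>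

definition C1_AC_on :: "real set \<Rightarrow> (real \<Rightarrow> real) \<Rightarrow> bool" where
  "C1_AC_on U u \<longleftrightarrow>
     (\<forall>x\<in>U. u differentiable (at x)) \<and> continuous_on U (deriv u) \<and>
     (\<forall>a b. a \<le> b \<and> {a..b} \<subseteq> U \<longrightarrow> abs_cont_on_interval (deriv u) a b)"

text \<open>Intervals may be open, closed, unbounded or degenerate (a single point).\<close>

definition finite_union_of_intervals :: "real set \<Rightarrow> bool" where
  "finite_union_of_intervals S \<longleftrightarrow>
     (\<exists>F. finite F \<and> (\<forall>I\<in>F. is_interval I) \<and> S = \<Union>F)"

text \<open>The operator $\mathcal{L}u = \frac12 u'' - \delta u$. When \<open>u\<close> satisfies
  \<open>C1_AC_on (- B) u\<close> with \<open>B\<close> finite, \<open>deriv u\<close> is differentiable almost everywhere, so that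
  almost-everywhere conditions on \<open>Lop \<delta> u\<close> do not depend on the default value of \<open>deriv\<close>.\<close>

definition Lop :: "real \<Rightarrow> (real \<Rightarrow> real) \<Rightarrow> real \<Rightarrow> real" where
  "Lop \<delta> u x = 1 / 2 * deriv (deriv u) x - \<delta> * u x"

definition ctrl_region :: "real set \<Rightarrow> (real \<Rightarrow> real) \<Rightarrow> real set" where
  "ctrl_region B u = closure (interior {x. x \<notin> B \<and> \<bar>deriv u x\<bar> = 1})"

definition stopW_region :: "(real \<Rightarrow> real) \<Rightarrow> (real \<Rightarrow> real) \<Rightarrow> real set" where
  "stopW_region g u = {x. u x = g x}"

definition stopC_region :: "(real \<Rightarrow> real) \<Rightarrow> (real \<Rightarrow> real) \<Rightarrow> real set" where
  "stopC_region g u = closure {x. u x < g x}"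

definition stop_region :: "(real \<Rightarrow> real) \<Rightarrow> (real \<Rightarrow> real) \<Rightarrow> real set" where
  "stop_region g u = stopW_region g u \<union> stopC_region g u"

definition wait_region :: "real set \<Rightarrow> (real \<Rightarrow> real) \<Rightarrow> (real \<Rightarrow> real) \<Rightarrow> real set" where
  "wait_region B g u = - (ctrl_region B u \<union> stop_region g u)"

text \<open>In the last of the four almost-everywhere conditions there is no sign requirement on
  $\mathcal{L}u + h$; what remains is that $u''$ exists.\<close>

definition candidate_wrt ::
    "real \<Rightarrow> (real \<Rightarrow> real) \<Rightarrow> (real \<Rightarrow> real) \<Rightarrow> real set \<Rightarrow> (real \<Rightarrow> real) \<Rightarrow> bool" where
  "candidate_wrt \<delta> h g B u \<longleftrightarrow>
     finite B \<and> continuous_on UNIV u \<and> (\<forall>x. 0 \<le> u x) \<and> C1_AC_on (- B) u \<and>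
     (\<forall>x. x \<notin> B \<longrightarrow> \<bar>deriv u x\<bar> \<le> 1) \<and>
     finite_union_of_intervals (ctrl_region B u) \<and>
     finite_union_of_intervals (stopW_region g u) \<and>
     finite_union_of_intervals (stopC_region g u) \<and>
     B \<subseteq> stopC_region g u \<and> stopC_region g u \<subseteq> ctrl_region B u \<and>
     (AE x in lborel. x \<in> wait_region B g u \<longrightarrow> Lop \<delta> u x + h x = 0) \<and>
     (AE x in lborel. x \<in> interior (ctrl_region B u - stop_region g u) \<longrightarrow> Lop \<delta> u x + h x \<ge> 0) \<and>
     (AE x in lborel. x \<in> interior (stopW_region g u) \<longrightarrow>
        Lop \<delta> u x + h x = Lop \<delta> g x + h x \<and> Lop \<delta> g x + h x \<le> 0) \<and>
     (AE x in lborel. x \<in> interior (stopC_region g u) - B \<longrightarrow> (deriv u) differentiable (at x)) \<and>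
     (\<forall>c\<in>B. \<exists>l r. (u has_real_derivative l) (at_left c) \<and> (u has_real_derivative r) (at_right c) \<and>
        (l = 1 \<and> r < 1 \<or> l > -1 \<and> r = -1))"

definition is_candidate ::
    "real \<Rightarrow> (real \<Rightarrow> real) \<Rightarrow> (real \<Rightarrow> real) \<Rightarrow> (real \<Rightarrow> real) \<Rightarrow> bool" where
  "is_candidate \<delta> h g u \<longleftrightarrow> (\<exists>B. candidate_wrt \<delta> h g B u)"

definition running_payoff :: "real \<Rightarrow> real \<Rightarrow> real \<Rightarrow> real" where
  "running_payoff \<kappa> \<mu> x = \<kappa> * x\<^sup>2 + \<mu>"

definition terminal_payoff :: "real \<Rightarrow> real \<Rightarrow> real" where
  "terminal_payoff lam x = lam * x\<^sup>2"

definition rho :: "real \<Rightarrow> real \<Rightarrow> real \<Rightarrow> real \<Rightarrow> real" where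
  "rho \<delta> \<kappa> lam \<mu> = sqrt ((\<kappa> + \<delta> * \<mu>) / (\<delta> * (\<delta> * lam - \<kappa>)))"

definition alpha_rhs :: "real \<Rightarrow> real \<Rightarrow> real \<Rightarrow> real \<Rightarrow> real \<Rightarrow> real" where
  "alpha_rhs \<delta> \<kappa> lam \<mu> \<alpha> =
     \<delta> * (\<delta> - 2 * \<kappa> * \<alpha>) /
     (sqrt (2 * \<delta>) * (\<delta> * (\<delta> * lam - \<kappa>) * \<alpha>\<^sup>2 - (\<kappa> + \<delta> * \<mu>)))"

text \<open>The right-hand side is singular only at \<open>\<alpha> = rho \<delta> \<kappa> lam \<mu>\<close>, where it evaluates to
  \<open>0 < tanh (sqrt (2 * \<delta>) * \<alpha>)\<close>; the convention \<open>x / 0 = 0\<close> thus adds no solution.\<close>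

definition alpha_eq :: "real \<Rightarrow> real \<Rightarrow> real \<Rightarrow> real \<Rightarrow> real \<Rightarrow> bool" where
  "alpha_eq \<delta> \<kappa> lam \<mu> \<alpha> \<longleftrightarrow> tanh (sqrt (2 * \<delta>) * \<alpha>) = alpha_rhs \<delta> \<kappa> lam \<mu> \<alpha>"

definition coeffA :: "real \<Rightarrow> real \<Rightarrow> real \<Rightarrow> real \<Rightarrow> real \<Rightarrow> real" where
  "coeffA \<delta> \<kappa> lam \<mu> \<alpha> =
     (\<delta> * (\<delta> * lam - \<kappa>) * \<alpha>\<^sup>2 - (\<kappa> + \<delta> * \<mu>)) / (\<delta>\<^sup>2 * cosh (sqrt (2 * \<delta>) * \<alpha>))"

definition u_inner :: "real \<Rightarrow> real \<Rightarrow> real \<Rightarrow> real \<Rightarrow> real \<Rightarrow> real \<Rightarrow> real" where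
  "u_inner \<delta> \<kappa> lam \<mu> \<alpha> x =
     coeffA \<delta> \<kappa> lam \<mu> \<alpha> * cosh (sqrt (2 * \<delta>) * x) + \<kappa> / \<delta> * x\<^sup>2 + (\<kappa> + \<delta> * \<mu>) / \<delta>\<^sup>2"

definition u_cand :: "real \<Rightarrow> real \<Rightarrow> real \<Rightarrow> real \<Rightarrow> real \<Rightarrow> real \<Rightarrow> real" where
  "u_cand \<delta> \<kappa> lam \<mu> \<alpha> x =
     (if \<bar>x\<bar> \<le> \<alpha> then u_inner \<delta> \<kappa> lam \<mu> \<alpha> x
      else \<bar>x\<bar> - \<alpha> + u_inner \<delta> \<kappa> lam \<mu> \<alpha> \<alpha>)"

text \<open>The condition on \<open>tanh (sqrt (2 * \<delta>) / (2 * lam))\<close> in the theorem compares the two sides of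
  the equation for \<open>\<alpha>\<close> at the point \<open>1 / (2 * lam)\<close>. The printed source omits the factor 2 in the
  numerator below; \<open>printed_condition_fails\<close> refutes the equivalence without that factor.\<close>

lemma alpha_rhs_at_inverse_2lam:
  fixes \<delta> \<kappa> lam \<mu> :: real
  assumes "\<delta> > 0" "lam > 0"
  shows "alpha_rhs \<delta> \<kappa> lam \<mu> (1 / (2 * lam)) =
    2 * sqrt (2 * \<delta>) * (\<delta> * lam - \<kappa>) * lam /
      (\<delta> * (\<delta> * lam - \<kappa>) - 4 * (\<kappa> + \<delta> * \<mu>) * lam\<^sup>2)"
proof -
  define s where "s = sqrt (2 * \<delta>)"
  define D where "D = \<delta> * (\<delta> * lam - \<kappa>) - 4 * (\<kappa> + \<delta> * \<mu>) * lam\<^sup>2"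
  have s: "s > 0" "s * s = 2 * \<delta>" using assms by (simp_all add: s_def)
  have num: "\<delta> * (\<delta> - 2 * \<kappa> * (1 / (2 * lam))) = s * (s / 2 * (\<delta> * lam - \<kappa>) / lam)"
  proof -
    have "\<delta> - 2 * \<kappa> * (1 / (2 * lam)) = (\<delta> * lam - \<kappa>) / lam"
      using assms by (simp add: field_simps)
    moreover have "s * (s / 2 * (\<delta> * lam - \<kappa>) / lam) = (s * s) / 2 * ((\<delta> * lam - \<kappa>) / lam)"
      by simp
    ultimately show ?thesis unfolding s(2) by simp
  qed
  have den: "\<delta> * (\<delta> * lam - \<kappa>) * (1 / (2 * lam))\<^sup>2 - (\<kappa> + \<delta> * \<mu>) = D / (4 * lam\<^sup>2)"
    using assms by (simp add: D_def field_simps power2_eq_square)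
  have "alpha_rhs \<delta> \<kappa> lam \<mu> (1 / (2 * lam)) = (s / 2 * (\<delta> * lam - \<kappa>) / lam) / (D / (4 * lam\<^sup>2))"
    unfolding alpha_rhs_def num den s_def[symmetric] using s(1) by simp
  also have "\<dots> = 2 * s * (\<delta> * lam - \<kappa>) * lam / D"
    using assms by (cases "D = 0") (simp_all add: field_simps power2_eq_square)
  finally show ?thesis by (simp add: s_def D_def)
qed

lemma printed_condition_fails:
  "\<exists>\<delta> \<kappa> lam \<mu> \<alpha>. \<delta> > 0 \<and> \<kappa> > 0 \<and> lam > 0 \<and> \<mu> \<ge> 0 \<and> \<delta> * lam - \<kappa> > 0 \<and>
     rho \<delta> \<kappa> lam \<mu> < \<delta> / (2 * \<kappa>) \<and> \<alpha> > 0 \<and> alpha_eq \<delta> \<kappa> lam \<mu> \<alpha> \<and>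
     1 / (2 * lam) < \<alpha> \<and> 1 / (2 * lam) > rho \<delta> \<kappa> lam \<mu> \<and>
     \<not> tanh (sqrt (2 * \<delta>) / (2 * lam)) <
         sqrt (2 * \<delta>) * (\<delta> * lam - \<kappa>) * lam /
           (\<delta> * (\<delta> * lam - \<kappa>) - 4 * (\<kappa> + \<delta> * \<mu>) * lam\<^sup>2)"
proof -
  let ?f = "\<lambda>a::real. (2 - a / 5) / (9 / 5 * a\<^sup>2 - 1 / 10)"
  have rho: "rho 2 (1/10) (1/2) 0 < 1"
    by (simp add: rho_def)
  have pos: "9 / 5 * a\<^sup>2 - 1 / 10 > 0" if "a \<ge> 1" for a :: real
    using one_le_power[OF that, of 2] by linarith
  have "\<exists>a\<ge>1. a \<le> 10 \<and> tanh (2 * a) - ?f a = 0"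
  proof (rule IVT')
    show "tanh (2 * (1::real)) - ?f 1 \<le> 0"
      using tanh_real_lt_1[of 2] by simp
    show "0 \<le> tanh (2 * (10::real)) - ?f 10" by simp
    show "continuous_on {1..10} (\<lambda>a. tanh (2 * a) - ?f a)"
      using pos by (intro continuous_intros) (auto simp: less_imp_neq[symmetric])
  qed simp
  then obtain a :: real where a: "a \<ge> 1" "a \<le> 10" "tanh (2 * a) = ?f a" by auto
  have "a \<noteq> 1" using a(3) tanh_real_lt_1[of 2] by auto
  then have a1: "a > 1" using a(1) by simp
  have eq: "alpha_eq 2 (1/10) (1/2) 0 a"
  proof -
    have "?f a = (2 * (2 - a / 5)) / (2 * (9 / 5 * a\<^sup>2 - 1 / 10))"
      by (rule mult_divide_mult_cancel_left[symmetric]) simp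
    then show ?thesis unfolding alpha_eq_def alpha_rhs_def by (simp add: a(3))
  qed
  have key: "2 / 3 \<le> (1 - e) / (1 + e)" if "0 < e" "e \<le> 1 / 5" for e :: real
    using that by (simp add: field_simps)
  have "exp (4::real) \<ge> 5" using exp_ge_add_one_self[of "4::real"] by simp
  then have "exp (- 4 :: real) \<le> 1 / 5" by (simp add: exp_minus field_simps)
  then have "2 / 3 \<le> (1 - exp (- 4 :: real)) / (1 + exp (- 4))" by (intro key) simp_all
  then have t: "tanh (2::real) \<ge> 2 / 3" by (simp add: tanh_real_altdef)
  show ?thesis
    by (rule exI[of _ 2], rule exI[of _ "1/10"], rule exI[of _ "1/2"], rule exI[of _ 0],
        rule exI[of _ a]) (use rho eq a1 t in \<open>simp add: power2_eq_square\<close>)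
qed

end

theory Submission
  imports Defs
begin

text \<open>
  For a trial point \<open>x > 0\<close> choose the coefficient of the \<open>cosh\<close>-term in
  \<open>A * cosh (sqrt (2 * \<delta>) * y) + \<kappa> / \<delta> * y\<^sup>2 + (\<kappa> + \<delta> * \<mu>) / \<delta>\<^sup>2\<close> (the even solutions of
  \<open>\<L>w + h = 0\<close>) so that the solution meets \<open>g\<close> at \<open>x\<close>. The equation for \<open>\<alpha>\<close> says that this
  solution has slope 1 at \<open>x\<close>. The defect of the slope, scaled by \<open>\<delta>\<^sup>2\<close>, is \<open>fit_gap x\<close> below. It is
  positive at 0 and, because \<open>tanh\<close> is increasing while \<open>tanh x / x\<close> is decreasing, it cannot return to
  a nonnegative value once it has been nonpositive (\<open>fit_gap_single_crossing\<close>). Hence there is exactly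
  one root \<open>\<alpha>\<close>, and \<open>x < \<alpha>\<close> is equivalent to \<open>0 < fit_gap x\<close> (\<open>fit_gap_sign\<close>). This turns every comparison
  of \<open>\<alpha>\<close> with an explicit number into an explicit inequality: with \<open>\<rho>\<close> and \<open>\<delta> / (2 * \<kappa>)\<close>, where
  \<open>fit_gap\<close> has an obvious sign, with \<open>1 / (2 * lam)\<close>, and with \<open>sqrt (\<mu> / (\<delta> * lam - \<kappa>))\<close>, the trial
  point at which the solution chosen for it has zero second derivative.

  At the root the solution \<open>w\<close> meets \<open>g\<close> at \<open>\<plusminus>\<alpha>\<close> with slopes \<open>\<plusminus>1\<close>, so the continuation with slopes \<open>\<plusminus>1\<close>
  is \<open>C\<^sup>1\<close> with Lipschitz derivative, and the empty exceptional set serves as \<open>\<B>\<close>. If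
  \<open>2 * lam * \<alpha> > 1\<close>, then \<open>g\<close> lies strictly above the continuation for \<open>\<bar>x\<bar> > \<alpha>\<close> and strictly below
  \<open>w\<close> for \<open>\<bar>x\<bar> < \<alpha>\<close>. All regions are then explicit, \<open>(-\<alpha>, \<alpha>)\<close> being the waiting region, and the only
  condition that can fail is \<open>\<bar>w'\<bar> \<le> 1\<close> on that interval. If \<open>\<delta> / (2 * \<kappa>) < \<rho>\<close>, then \<open>A < 0\<close> and
  \<open>2 * lam * \<alpha> > 1\<close> is automatic, since \<open>1 / (2 * lam) < \<delta> / (2 * \<kappa>) < \<alpha>\<close>. For \<open>A > 0\<close> the function \<open>w\<close> is convex and the
  condition holds. For \<open>A < 0\<close> the derivative \<open>w''\<close> decreases on \<open>[0, \<alpha>]\<close>: if \<open>w'' \<alpha> \<ge> 0\<close> then \<open>w'\<close>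
  increases up to the value 1, whereas \<open>w'' \<alpha> < 0\<close> makes \<open>w'\<close> exceed 1 on a whole interval to the left of
  \<open>\<alpha>\<close>, which a finite exceptional set cannot hide. So in this case being a candidate means
  \<open>w'' \<alpha> \<ge> 0\<close>, which is the stated inequality.
\<close>

section \<open>Slopes of chords from the origin\<close>

text \<open>This is \<open>f x / x \<le> f y / y\<close> without denominators: by the mean value theorem the left-hand slope is a
  value of \<open>f'\<close> before \<open>x\<close>, and the slope from \<open>x\<close> to \<open>y\<close> is a value of \<open>f'\<close> after \<open>x\<close>.\<close>

lemma slope_from_0_mono:
  fixes f f' :: "real \<Rightarrow> real"
  assumes der: "\<And>t. (f has_real_derivative f' t) (at t)" and "f 0 = 0"
    and mono: "\<And>t u. 0 \<le> t \<Longrightarrow> t \<le> u \<Longrightarrow> f' t \<le> f' u"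
    and "0 \<le> x" "x \<le> y"
  shows "f x * y \<le> f y * x"
proof (cases "x = 0 \<or> x = y")
  case False
  then have x: "0 < x" "x < y" using assms by auto
  obtain t where t: "0 < t" "t < x" "f x - f 0 = (x - 0) * f' t"
    using MVT2[OF x(1) der] by auto
  obtain u where u: "x < u" "u < y" "f y - f x = (y - x) * f' u"
    using MVT2[OF x(2) der] by auto
  have "f' t \<le> f' u" using t u by (intro mono) auto
  then have "0 \<le> x * (y - x) * (f' u - f' t)" using x by simp
  moreover have fx: "f x = x * f' t" using t(3) \<open>f 0 = 0\<close> by simp
  have "f y = x * f' t + (y - x) * f' u" using u(3) fx by simp
  then have "f y * x - f x * y = x * (y - x) * (f' u - f' t)"
    unfolding fx by (simp only:) (simp add: algebra_simps)
  ultimately show ?thesis by simp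
qed (use \<open>f 0 = 0\<close> in auto)

lemma tanh_slope_from_0_antimono:
  fixes x y :: real
  assumes "0 \<le> x" "x \<le> y"
  shows "tanh y * x \<le> tanh x * y"
proof -
  have "- tanh x * y \<le> - tanh y * x"
  proof (rule slope_from_0_mono[where f' = "\<lambda>t. - (1 - (tanh t)\<^sup>2)"])
    show "((\<lambda>x. - tanh x) has_real_derivative - (1 - (tanh t)\<^sup>2)) (at t)" for t :: real
      by (auto intro!: derivative_eq_intros)
  qed (use assms in \<open>auto intro: power_mono\<close>)
  then show ?thesis by simp
qed

lemma sinh_slope_from_0_mono:
  fixes x y :: real
  assumes "0 \<le> x" "x \<le> y"
  shows "sinh x * y \<le> sinh y * x"
proof (rule slope_from_0_mono[where f' = cosh])
  show "(sinh has_real_derivative cosh t) (at t)" for t :: real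
    by (auto intro!: derivative_eq_intros)
qed (use assms in \<open>auto simp: cosh_real_nonneg_le_iff\<close>)

section \<open>Continuation of an even function with slopes 1 and -1\<close>

lemma abs_cont_on_interval_Lipschitz:
  assumes "\<And>x y. \<bar>f x - f y\<bar> \<le> L * \<bar>x - y\<bar>"
  shows "abs_cont_on_interval f a b"
  unfolding abs_cont_on_interval_def
proof (intro allI impI)
  fix \<epsilon> :: real assume "\<epsilon> > 0"
  have "\<bar>f 0 - f 1\<bar> \<le> L" using assms[of 0 1] by simp
  then have L: "L \<ge> 0" by linarith
  show "\<exists>\<eta>>0. \<forall>P. finite P \<and> (\<forall>(s, t)\<in>P. a \<le> s \<and> s \<le> t \<and> t \<le> b) \<and>
      disjoint_family_on (\<lambda>(s, t). {s<..<t}) P \<and> (\<Sum>(s, t)\<in>P. t - s) < \<eta> \<longrightarrow>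
      (\<Sum>(s, t)\<in>P. \<bar>f t - f s\<bar>) < \<epsilon>"
  \<comment> \<open>\<open>L + 1\<close> instead of \<open>L\<close> also covers \<open>L = 0\<close>.\<close>
  proof (intro exI[of _ "\<epsilon> / (L + 1)"] conjI allI impI)
    show "\<epsilon> / (L + 1) > 0" using \<open>\<epsilon> > 0\<close> L by simp
    fix P :: "(real \<times> real) set"
    assume P: "finite P \<and> (\<forall>(s, t)\<in>P. a \<le> s \<and> s \<le> t \<and> t \<le> b) \<and>
      disjoint_family_on (\<lambda>(s, t). {s<..<t}) P \<and> (\<Sum>(s, t)\<in>P. t - s) < \<epsilon> / (L + 1)"
    have "(\<Sum>(s, t)\<in>P. \<bar>f t - f s\<bar>) \<le> (\<Sum>(s, t)\<in>P. (L + 1) * (t - s))"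
    proof (rule sum_mono, clarify)
      fix s t assume "(s, t) \<in> P"
      then have "s \<le> t" using P by auto
      then show "\<bar>f t - f s\<bar> \<le> (L + 1) * (t - s)"
        using assms[of t s] by (simp add: algebra_simps)
    qed
    also have "\<dots> = (L + 1) * (\<Sum>(s, t)\<in>P. t - s)"
      by (simp add: sum_distrib_left case_prod_unfold)
    also have "\<dots> < (L + 1) * (\<epsilon> / (L + 1))"
      using P L by (intro mult_strict_left_mono) auto
    finally show "(\<Sum>(s, t)\<in>P. \<bar>f t - f s\<bar>) < \<epsilon>" using L by simp
  qed
qed

lemma DERIV_If_le:
  fixes f g :: "real \<Rightarrow> real"
  assumes f: "(f has_real_derivative D) (at a)" and g: "(g has_real_derivative D) (at a)"
    and eq: "f a = g a"
  shows "((\<lambda>x. if x \<le> a then f x else g x) has_real_derivative D) (at a)"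
proof -
  let ?k = "\<lambda>x. if x \<le> a then f x else g x"
  have "(?k has_real_derivative D) (at_left a)"
    using has_field_derivative_at_within[OF f]
    by (subst has_field_derivative_cong_eventually[of _ f]) (auto simp: eventually_at_filter)
  moreover have "(?k has_real_derivative D) (at_right a)"
    using has_field_derivative_at_within[OF g]
    by (subst has_field_derivative_cong_eventually[of _ g]) (auto simp: eventually_at_filter eq)
  ultimately show ?thesis by (simp add: has_field_derivative_iff filterlim_at_split)
qed

text \<open>The shape shared by all functions \<open>u_cand\<close>; the argument about regions below only uses this shape and
  the behaviour of the core \<open>w\<close>, not the formula for it.\<close>

definition unit_slope_extension :: "(real \<Rightarrow> real) \<Rightarrow> real \<Rightarrow> real \<Rightarrow> real" where
  "unit_slope_extension w a x = (if \<bar>x\<bar> \<le> a then w x else \<bar>x\<bar> - a + w a)"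

locale even_core =
  fixes w w' w'' :: "real \<Rightarrow> real" and a :: real
  assumes a_pos: "a > 0"
    and even: "\<And>x. w (- x) = w x"
    and odd: "\<And>x. w' (- x) = - w' x"
    and deriv1: "\<And>x. (w has_real_derivative w' x) (at x)"
    and deriv2: "\<And>x. (w' has_real_derivative w'' x) (at x)"
    and cont2: "continuous_on {-a..a} w''"
    and smooth_fit: "w' a = 1"
begin

abbreviation "u \<equiv> unit_slope_extension w a"
abbreviation "proj \<equiv> \<lambda>x. max (- a) (min a x)"

text \<open>The derivative of \<open>u\<close> is \<open>w'\<close> composed with the projection onto \<open>[-a, a]\<close>, since \<open>w'\<close> takes the values
  \<open>\<plusminus>1\<close> at the end points. This one formula gives continuity and the Lipschitz bound at once.\<close>

lemma u_has_derivative: "(u has_real_derivative w' (proj x)) (at x)"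
proof -
  have pos: "(u has_real_derivative w' (proj x)) (at x)" if x: "x > - a" for x
  proof -
    let ?v = "\<lambda>x. if x \<le> a then w x else x - a + w a"
    have lin: "((\<lambda>x. x - a + w a) has_real_derivative 1) (at x)" for x
      by (auto intro!: derivative_eq_intros)
    consider "x < a" | "x = a" | "x > a" by linarith
    then have "(?v has_real_derivative w' (proj x)) (at x)"
    proof cases
      case 1
      have "(?v has_real_derivative w' x) (at x)"
        by (rule has_field_derivative_transform_within_open[OF deriv1, where S = "{..<a}"]) (use 1 in auto)
      then show ?thesis using 1 x by simp
    next
      case 2
      then show ?thesis
        using DERIV_If_le[OF deriv1[of a], of "\<lambda>x. x - a + w a"] lin a_pos by (simp add: smooth_fit)
    next
      case 3
      have "(?v has_real_derivative 1) (at x)"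
        by (rule has_field_derivative_transform_within_open[OF lin, where S = "{a<..}"]) (use 3 in auto)
      then show ?thesis using 3 a_pos by (simp add: smooth_fit)
    qed
    then show ?thesis
      by (rule has_field_derivative_transform_within_open[where S = "{- a<..}"])
         (use x a_pos in \<open>auto simp: unit_slope_extension_def\<close>)
  qed
  show ?thesis
  proof (cases "x > - a")
    case False
    have u_even: "u (- y) = u y" for y by (simp add: unit_slope_extension_def even)
    have "(u has_real_derivative w' (proj (- x))) (at (- x))"
      by (rule pos) (use False a_pos in auto)
    then have "((\<lambda>y. u (- y)) has_real_derivative - w' (proj (- x))) (at x)"
      using DERIV_mirror[of u "w' (proj (- x))" x] by simp
    moreover have "- w' (proj (- x)) = w' (proj x)"
      using False a_pos odd[of a] by simp
    ultimately show ?thesis by (simp add: u_even)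
  qed (rule pos)
qed

lemma deriv_u: "deriv u x = w' (proj x)"
  by (rule DERIV_imp_deriv[OF u_has_derivative])

lemma deriv_u_Lipschitz: "\<exists>L. \<forall>x y. \<bar>deriv u x - deriv u y\<bar> \<le> L * \<bar>x - y\<bar>"
proof -
  have "bounded (w'' ` {-a..a})"
    by (intro compact_imp_bounded compact_continuous_image cont2) simp
  then obtain L where L: "L > 0" "\<And>x. x \<in> {-a..a} \<Longrightarrow> \<bar>w'' x\<bar> \<le> L"
    unfolding bounded_pos by auto
  have core: "\<bar>w' x - w' y\<bar> \<le> L * \<bar>x - y\<bar>" if "x \<in> {-a..a}" "y \<in> {-a..a}" for x y
    using field_differentiable_bound[OF convex_real_interval(5) has_field_derivative_at_within[OF deriv2] _ that]
      L(2) by simp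
  have "\<bar>deriv u x - deriv u y\<bar> \<le> L * \<bar>x - y\<bar>" for x y
  proof -
    have "\<bar>w' (proj x) - w' (proj y)\<bar> \<le> L * \<bar>proj x - proj y\<bar>"
      by (rule core) (use a_pos in auto)
    also have "\<dots> \<le> L * \<bar>x - y\<bar>" using L(1) by (intro mult_left_mono) auto
    finally show ?thesis by (simp add: deriv_u)
  qed
  then show ?thesis by blast
qed

lemma C1_AC_on_u: "C1_AC_on U u"
proof -
  obtain L where "\<And>x y. \<bar>deriv u x - deriv u y\<bar> \<le> L * \<bar>x - y\<bar>" using deriv_u_Lipschitz by blast
  then have "abs_cont_on_interval (deriv u) c d" for c d by (rule abs_cont_on_interval_Lipschitz)
  moreover have "isCont w' x" for x using deriv2 by (rule DERIV_isCont)
  then have "continuous_on UNIV w'" by (simp add: continuous_at_imp_continuous_on)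
  then have "continuous_on U (\<lambda>x. w' (proj x))"
    by (rule continuous_on_compose2) (auto intro!: continuous_intros)
  then have "continuous_on U (deriv u)" by (simp add: deriv_u[abs_def])
  moreover have "u differentiable (at x)" for x
    using u_has_derivative real_differentiable_def by blast
  ultimately show ?thesis by (simp add: C1_AC_on_def)
qed

lemma deriv2_u_inner:
  assumes "\<bar>x\<bar> < a"
  shows "deriv (deriv u) x = w'' x"
proof (rule DERIV_imp_deriv)
  show "(deriv u has_real_derivative w'' x) (at x)"
    by (rule has_field_derivative_transform_within_open[OF deriv2, where S = "{-a<..<a}"])
       (use assms in \<open>auto simp: deriv_u\<close>)
qed

lemma deriv_u_differentiable_outer:
  assumes "\<bar>x\<bar> > a"
  shows "deriv u differentiable (at x)"
proof -
  have "(deriv u has_real_derivative 0) (at x)"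
  proof (cases "x > 0")
    case True
    show ?thesis
      by (rule has_field_derivative_transform_within_open[OF DERIV_const[of "w' a"], where S = "{a<..}"])
         (use assms True a_pos in \<open>auto simp: deriv_u\<close>)
  next
    case False
    show ?thesis
      by (rule has_field_derivative_transform_within_open[OF DERIV_const[of "w' (- a)"], where S = "{..<-a}"])
         (use assms False a_pos in \<open>auto simp: deriv_u\<close>)
  qed
  then show ?thesis using real_differentiable_def by blast
qed

text \<open>The hypotheses place \<open>g\<close> below \<open>u\<close> exactly on \<open>(-a, a)\<close> and make \<open>\<bar>u'\<bar> = 1\<close> exactly outside it. So
  control region, stopping region and the closure of \<open>{u < g}\<close> all equal the complement of \<open>(-a, a)\<close>,
  the set \<open>{u = g}\<close> is \<open>{-a, a}\<close>, and the waiting region is \<open>(-a, a)\<close>; the conditions on the interiors of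
  \<open>\<C> - \<S>\<close> and of \<open>{u = g}\<close> are vacuous.\<close>

lemma candidate_u:
  assumes slope: "\<And>x. \<bar>x\<bar> < a \<Longrightarrow> \<bar>w' x\<bar> < 1"
    and value_match: "w a = lam * a\<^sup>2"
    and above: "\<And>x. \<bar>x\<bar> < a \<Longrightarrow> lam * x\<^sup>2 < w x"
    and "lam > 0" and steep: "1 \<le> 2 * lam * a"
    and ode: "\<And>x. \<bar>x\<bar> < a \<Longrightarrow> 1 / 2 * w'' x - \<delta> * w x + h x = 0"
  shows "candidate_wrt \<delta> h (terminal_payoff lam) {} u"
proof -
  let ?g = "terminal_payoff lam" and ?I = "{-a<..<a}" and ?J = "{-a..a}"
  have w'_edge: "w' (- a) = - 1" using odd[of a] smooth_fit by simp
  have w_edge: "w (- a) = lam * a\<^sup>2" using even value_match by simp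
  have outer: "u x < ?g x" if x: "\<bar>x\<bar> > a" for x
  proof -
    \<comment> \<open>\<open>g - u = (\<bar>x\<bar> - a) * (lam * (\<bar>x\<bar> + a) - 1)\<close>\<close>
    have "2 * lam * a < lam * (\<bar>x\<bar> + a)" using x \<open>lam > 0\<close> by simp
    then have "(\<bar>x\<bar> - a) * 1 < (\<bar>x\<bar> - a) * (lam * (\<bar>x\<bar> + a))"
      using steep x by (intro mult_strict_left_mono) auto
    also have "\<dots> = lam * (\<bar>x\<bar>\<^sup>2 - a\<^sup>2)" by (simp add: power2_eq_square algebra_simps)
    finally show ?thesis
      using x by (simp add: unit_slope_extension_def terminal_payoff_def value_match algebra_simps)
  qed
  have inner: "?g x < u x" if "\<bar>x\<bar> < a" for x
    using above[OF that] that by (simp add: unit_slope_extension_def terminal_payoff_def)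
  have edge: "u x = ?g x" if "\<bar>x\<bar> = a" for x
    using that value_match w_edge
    by (auto simp: unit_slope_extension_def terminal_payoff_def abs_if split: if_splits)
  have closure_I: "closure ?I = ?J" using a_pos by simp
  have "{x. x \<notin> {} \<and> \<bar>deriv u x\<bar> = 1} = - ?I"
  proof (intro set_eqI)
    fix x
    consider "\<bar>x\<bar> < a" | "x \<le> - a" | "x \<ge> a" by linarith
    then show "x \<in> {x. x \<notin> {} \<and> \<bar>deriv u x\<bar> = 1} \<longleftrightarrow> x \<in> - ?I"
      by cases (use slope[of x] a_pos in \<open>auto simp: deriv_u less_imp_neq smooth_fit w'_edge\<close>)
  qed
  then have ctrl: "ctrl_region {} u = - ?I"
    by (simp only: ctrl_region_def interior_complement closure_I closure_complement)
       (use a_pos in simp)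
  have "{x. u x < ?g x} = - ?J"
  proof (intro set_eqI)
    fix x show "x \<in> {x. u x < ?g x} \<longleftrightarrow> x \<in> - ?J"
      using outer[of x] inner[of x] edge[of x] by fastforce
  qed
  then have stopC: "stopC_region ?g u = - ?I"
    by (simp only: stopC_region_def closure_complement) (use a_pos in simp)
  have stopW: "stopW_region ?g u = {-a, a}"
  proof (intro set_eqI)
    fix x show "x \<in> stopW_region ?g u \<longleftrightarrow> x \<in> {-a, a}"
      unfolding stopW_region_def using outer[of x] inner[of x] edge[of x] a_pos
      by (cases "\<bar>x\<bar>" a rule: linorder_cases) (auto simp: abs_if split: if_splits)
  qed
  have stop: "stop_region ?g u = - ?I" using a_pos by (auto simp: stop_region_def stopC stopW)
  have wait: "wait_region {} ?g u = ?I" by (simp add: wait_region_def ctrl stop)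
  have int_stopC: "interior (stopC_region ?g u) = - ?J"
    by (simp only: stopC interior_complement closure_I)
  have two_intervals: "finite_union_of_intervals (I \<union> J)"
    if "is_interval I" "is_interval J" for I J :: "real set"
    unfolding finite_union_of_intervals_def by (rule exI[of _ "{I, J}"]) (use that in auto)
  have intervals: "finite_union_of_intervals (- ?I)" "finite_union_of_intervals {-a, a}"
  proof -
    have "- ?I = {..-a} \<union> {a..}" "{-a, a} = {-a..-a} \<union> {a..a}" by auto
    moreover have "is_interval {..-a}" "is_interval {a..}" "is_interval {-a..-a}" "is_interval {a..a}"
      by (auto simp: is_interval_1)
    ultimately show "finite_union_of_intervals (- ?I)" "finite_union_of_intervals {-a, a}"
      using two_intervals by metis+
  qed
  have nonneg: "0 \<le> u x" for x
  proof (cases "\<bar>x\<bar> < a")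
    case True
    have "0 \<le> ?g x" using \<open>lam > 0\<close> by (simp add: terminal_payoff_def)
    then show ?thesis using inner[OF True] by simp
  next
    case False
    then show ?thesis
      using \<open>lam > 0\<close> w_edge value_match a_pos
      by (auto simp: unit_slope_extension_def abs_if split: if_splits)
  qed
  have slope_le: "\<bar>deriv u x\<bar> \<le> 1" for x
  proof -
    consider "\<bar>x\<bar> < a" | "x \<le> - a" | "x \<ge> a" by linarith
    then show ?thesis
      by cases (use slope[of x] a_pos in \<open>auto simp: deriv_u less_imp_neq smooth_fit w'_edge\<close>)
  qed
  have ode_u: "Lop \<delta> u x + h x = 0" if "x \<in> ?I" for x
    using ode[of x] deriv2_u_inner[of x] that by (auto simp: Lop_def unit_slope_extension_def)
  have cont: "continuous_on UNIV u"
    using DERIV_isCont[OF u_has_derivative] by (simp add: continuous_at_imp_continuous_on)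
  show ?thesis
    unfolding candidate_wrt_def stop wait int_stopC
    unfolding ctrl stopW stopC
    using cont nonneg slope_le C1_AC_on_u intervals ode_u deriv_u_differentiable_outer
    by (auto simp: empty_interior_finite abs_le_iff not_le intro!: AE_I2)
qed

end

section \<open>The smooth-fit equation\<close>

locale payoff_data =
  fixes \<delta> \<kappa> lam \<mu> :: real
  assumes pos: "\<delta> > 0" "\<kappa> > 0" "lam > 0" "\<mu> \<ge> 0"
    and excess_pos: "\<delta> * lam - \<kappa> > 0"
begin

abbreviation "s \<equiv> sqrt (2 * \<delta>)"
abbreviation "q x \<equiv> \<delta> * (\<delta> * lam - \<kappa>) * x\<^sup>2 - (\<kappa> + \<delta> * \<mu>)"
abbreviation "\<rho> \<equiv> rho \<delta> \<kappa> lam \<mu>"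

text \<open>If the even solution of \<open>\<L>w + h = 0\<close> is normalised by \<open>w x = g x\<close>, the coefficient of its \<open>cosh\<close>-term
  is \<open>q x / (\<delta>\<^sup>2 * cosh (s * x))\<close>, and \<open>fit_gap x = \<delta>\<^sup>2 * (1 - w' x)\<close>.\<close>

definition fit_gap :: "real \<Rightarrow> real" where
  "fit_gap x = \<delta> * (\<delta> - 2 * \<kappa> * x) - s * q x * tanh (s * x)"

lemma s_pos: "s > 0" and s_sq: "s * s = 2 * \<delta>"
  using pos by simp_all

lemma rho_pos: "\<rho> > 0"
  using pos excess_pos by (auto simp: rho_def intro!: divide_pos_pos mult_pos_pos add_pos_nonneg)

lemma q_factor: "q x = \<delta> * (\<delta> * lam - \<kappa>) * (x + \<rho>) * (x - \<rho>)"
proof -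
  have "\<rho>\<^sup>2 = (\<kappa> + \<delta> * \<mu>) / (\<delta> * (\<delta> * lam - \<kappa>))"
    using pos excess_pos by (simp add: rho_def)
  then have "\<kappa> + \<delta> * \<mu> = \<delta> * (\<delta> * lam - \<kappa>) * \<rho>\<^sup>2" using pos excess_pos by simp
  then show ?thesis by (simp add: power2_eq_square algebra_simps)
qed

lemma q_sign:
  assumes "x \<ge> 0"
  shows "q x < 0 \<longleftrightarrow> x < \<rho>" "0 < q x \<longleftrightarrow> \<rho> < x"
proof -
  define c where "c = \<delta> * (\<delta> * lam - \<kappa>) * (x + \<rho>)"
  have "c > 0" using pos excess_pos rho_pos assms by (simp add: c_def)
  then show "q x < 0 \<longleftrightarrow> x < \<rho>" "0 < q x \<longleftrightarrow> \<rho> < x"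
    unfolding q_factor c_def[symmetric] by (simp_all add: mult_less_0_iff zero_less_mult_iff)
qed

lemma slope_numerator_sign:
  "0 < \<delta> * (\<delta> - 2 * \<kappa> * x) \<longleftrightarrow> x < \<delta> / (2 * \<kappa>)"
  "\<delta> * (\<delta> - 2 * \<kappa> * x) < 0 \<longleftrightarrow> \<delta> / (2 * \<kappa>) < x"
  using pos by (simp_all add: zero_less_mult_iff mult_less_0_iff field_simps)

lemma q_strict_mono: "0 \<le> x \<Longrightarrow> x < y \<Longrightarrow> q x < q y"
  using pos excess_pos by (auto intro!: mult_strict_left_mono power_strict_mono)

text \<open>Clearing the denominator matters only at its zero \<open>\<rho>\<close>. There \<open>fit_gap\<close> equals
  \<open>\<delta> * (\<delta> - 2 * \<kappa> * \<rho>)\<close>, which is nonzero because \<open>\<rho>\<close> differs from \<open>\<delta> / (2 * \<kappa>)\<close>, and the original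
  equation reads \<open>tanh (s * \<rho>) = 0\<close> by the convention for division by zero, which is false.\<close>

lemma alpha_eq_iff:
  assumes "\<alpha> > 0" "\<rho> \<noteq> \<delta> / (2 * \<kappa>)"
  shows "alpha_eq \<delta> \<kappa> lam \<mu> \<alpha> \<longleftrightarrow> fit_gap \<alpha> = 0"
proof (cases "q \<alpha> = 0")
  case True
  then have "\<alpha> = \<rho>" using q_sign[of \<alpha>] assms(1) by auto
  then have "fit_gap \<alpha> \<noteq> 0" using True slope_numerator_sign[of \<alpha>] assms(2) by (auto simp: fit_gap_def)
  moreover have "\<not> alpha_eq \<delta> \<kappa> lam \<mu> \<alpha>"
    using True assms(1) s_pos by (simp add: alpha_eq_def alpha_rhs_def)
  ultimately show ?thesis by blast
next
  case False
  then have "s * q \<alpha> \<noteq> 0" using s_pos by simp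
  moreover have "t = p / c \<longleftrightarrow> p - c * t = 0" if "c \<noteq> 0" for t p c :: real
    using that by (auto simp: field_simps)
  ultimately show ?thesis unfolding alpha_eq_def alpha_rhs_def fit_gap_def by blast
qed

text \<open>The sign of \<open>q\<close> decides which property of \<open>tanh\<close> does the work. Where \<open>q \<ge> 0\<close>, both terms of \<open>fit_gap\<close>
  decrease because \<open>tanh\<close> increases. Where \<open>q \<le> 0\<close>, the function \<open>fit_gap x / x\<close> decreases: it is
  \<open>\<delta>\<^sup>2 / x - 2 * \<delta> * \<kappa> + s * (- q x) * (tanh (s * x) / x)\<close>, in which \<open>- q\<close> and the slope
  \<open>tanh (s * x) / x\<close> are nonnegative and decreasing. If \<open>q\<close> changes sign between \<open>x\<close> and \<open>y\<close>,
  nonpositivity at \<open>x\<close> already forces \<open>\<delta> - 2 * \<kappa> * x < 0\<close>, and this persists.\<close>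

lemma fit_gap_single_crossing:
  assumes "0 < x" "x < y" "fit_gap x \<le> 0"
  shows "fit_gap y < 0"
proof -
  have tx: "tanh (s * x) > 0" and ty: "tanh (s * y) > 0" using assms s_pos by auto
  have txy: "tanh (s * x) < tanh (s * y)" using assms s_pos by simp
  have qxy: "q x < q y" using assms by (intro q_strict_mono) auto
  have pxy: "\<delta> * (\<delta> - 2 * \<kappa> * y) < \<delta> * (\<delta> - 2 * \<kappa> * x)" using assms pos by simp
  consider "q x \<ge> 0" | "q x < 0" "q y > 0" | "q y \<le> 0" by linarith
  then show ?thesis
  proof cases
    case 1
    have "q x * tanh (s * x) \<le> q y * tanh (s * y)"
      using 1 qxy tx txy by (intro mult_mono) auto
    then have "s * (q x * tanh (s * x)) \<le> s * (q y * tanh (s * y))"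
      using s_pos by (intro mult_left_mono) auto
    then show ?thesis using assms(3) pxy by (simp add: fit_gap_def mult.assoc)
  next
    case 2
    have "s * q x * tanh (s * x) < 0" "s * q y * tanh (s * y) > 0"
      using 2 tx ty s_pos by (simp_all add: mult_less_0_iff)
    then show ?thesis using assms(3) pxy by (simp add: fit_gap_def)
  next
    case 3
    have "tanh (s * y) * (s * x) \<le> tanh (s * x) * (s * y)"
      using assms s_pos by (intro tanh_slope_from_0_antimono) auto
    then have "s * (tanh (s * y) * x) \<le> s * (tanh (s * x) * y)" by (simp add: mult_ac)
    then have slope: "tanh (s * y) * x \<le> tanh (s * x) * y" using s_pos by simp
    have "x * (- q y * tanh (s * y)) \<le> - q y * (tanh (s * x) * y)"
      using mult_left_mono[OF slope, of "- q y"] 3 by (simp add: mult_ac)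
    also have "\<dots> \<le> - q x * (tanh (s * x) * y)"
      using qxy tx assms by (intro mult_right_mono) auto
    finally have "s * (x * (- q y * tanh (s * y))) \<le> s * (- q x * (tanh (s * x) * y))"
      using s_pos by (intro mult_left_mono) auto
    moreover have "y * (\<delta> * (\<delta> - 2 * \<kappa> * x) - s * q x * tanh (s * x)) \<le> 0"
      using assms by (simp add: fit_gap_def mult_le_0_iff)
    moreover have "\<delta>\<^sup>2 * x < \<delta>\<^sup>2 * y" using assms pos by simp
    ultimately have "x * fit_gap y < 0"
      by (simp add: fit_gap_def algebra_simps power2_eq_square)
    then show ?thesis using assms by (simp add: mult_less_0_iff)
  qed
qed

text \<open>Outside the interval between \<open>\<rho>\<close> and \<open>\<delta> / (2 * \<kappa>)\<close> the two terms of \<open>fit_gap\<close> do not compete; the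
  end points are included because at each of them only one of the terms vanishes. It follows that the
  root lies strictly between the two numbers, whichever is larger.\<close>

lemma fit_gap_sign_outside:
  assumes "\<rho> \<noteq> \<delta> / (2 * \<kappa>)" "x \<ge> 0"
  shows "x \<le> \<rho> \<Longrightarrow> x \<le> \<delta> / (2 * \<kappa>) \<Longrightarrow> 0 < fit_gap x"
    and "\<rho> \<le> x \<Longrightarrow> \<delta> / (2 * \<kappa>) \<le> x \<Longrightarrow> fit_gap x < 0"
proof -
  have t: "0 \<le> s * tanh (s * x)" "x > 0 \<Longrightarrow> 0 < s * tanh (s * x)"
    using s_pos assms(2) by auto
  have gap: "fit_gap x = \<delta> * (\<delta> - 2 * \<kappa> * x) - q x * (s * tanh (s * x))"
    by (simp add: fit_gap_def mult_ac)
  show "0 < fit_gap x" if "x \<le> \<rho>" "x \<le> \<delta> / (2 * \<kappa>)"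
  proof (cases "x < \<delta> / (2 * \<kappa>)")
    case True
    have "q x * (s * tanh (s * x)) \<le> 0"
      using q_sign(2)[OF assms(2)] that t(1) by (intro mult_nonpos_nonneg) auto
    then show ?thesis using slope_numerator_sign(1)[of x] True by (simp add: gap)
  next
    case False
    then have x: "x = \<delta> / (2 * \<kappa>)" "x < \<rho>" "x > 0" using that assms(1) pos by auto
    have "q x * (s * tanh (s * x)) < 0"
      using q_sign(1)[OF assms(2)] x t(2) by (intro mult_neg_pos) auto
    moreover have "\<delta> * (\<delta> - 2 * \<kappa> * x) = 0" using x(1) pos by simp
    ultimately show ?thesis unfolding gap by linarith
  qed
  show "fit_gap x < 0" if "\<rho> \<le> x" "\<delta> / (2 * \<kappa>) \<le> x"
  proof (cases "\<delta> / (2 * \<kappa>) < x")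
    case True
    have "0 \<le> q x" using q_sign(1)[OF assms(2)] that by linarith
    then have "q x * (s * tanh (s * x)) \<ge> 0" by (rule mult_nonneg_nonneg[OF _ t(1)])
    then show ?thesis using slope_numerator_sign(2)[of x] True by (simp add: gap)
  next
    case False
    then have x: "x = \<delta> / (2 * \<kappa>)" "\<rho> < x" "x > 0" using that assms(1) pos by auto
    have "0 < q x" using q_sign(2)[OF assms(2)] x(2) by blast
    then have "q x * (s * tanh (s * x)) > 0" by (rule mult_pos_pos[OF _ t(2)[OF x(3)]])
    moreover have "\<delta> * (\<delta> - 2 * \<kappa> * x) = 0" using x(1) pos by simp
    ultimately show ?thesis unfolding gap by linarith
  qed
qed

lemma fit_gap_sign:
  assumes "\<rho> \<noteq> \<delta> / (2 * \<kappa>)" "\<alpha> > 0" "fit_gap \<alpha> = 0" "x \<ge> 0"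
  shows "0 < fit_gap x \<longleftrightarrow> x < \<alpha>" "0 \<le> fit_gap x \<longleftrightarrow> x \<le> \<alpha>"
proof -
  have "0 < fit_gap x" if "x < \<alpha>"
  proof (cases "x = 0")
    case True
    then show ?thesis using pos by (simp add: fit_gap_def)
  next
    case False
    then show ?thesis
      using fit_gap_single_crossing[of x \<alpha>] that assms by force
  qed
  moreover have "fit_gap x < 0" if "\<alpha> < x"
    using fit_gap_single_crossing[of \<alpha> x] that assms by simp
  ultimately show "0 < fit_gap x \<longleftrightarrow> x < \<alpha>" "0 \<le> fit_gap x \<longleftrightarrow> x \<le> \<alpha>"
    using assms(3) by (cases x \<alpha> rule: linorder_cases; force)+
qed

lemma ex1_fit_gap_zero:
  assumes "\<rho> \<noteq> \<delta> / (2 * \<kappa>)"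
  shows "\<exists>!\<alpha>. \<alpha> > 0 \<and> fit_gap \<alpha> = 0"
proof (rule ex_ex1I)
  define b where "b = max \<rho> (\<delta> / (2 * \<kappa>))"
  have "b > 0" "fit_gap 0 > 0" "fit_gap b < 0"
    using rho_pos pos fit_gap_sign_outside[OF assms] by (auto simp: b_def less_max_iff_disj)
  moreover have "continuous_on {0..b} fit_gap"
    unfolding fit_gap_def by (intro continuous_intros) auto
  ultimately obtain \<alpha> where "0 \<le> \<alpha>" "\<alpha> \<le> b" "fit_gap \<alpha> = 0"
    using IVT2'[of fit_gap b 0 0] by auto
  then show "\<exists>\<alpha>. \<alpha> > 0 \<and> fit_gap \<alpha> = 0"
    using \<open>fit_gap 0 > 0\<close> by (metis less_irrefl order_le_less)
next
  show "\<alpha> = \<beta>" if "\<alpha> > 0 \<and> fit_gap \<alpha> = 0" "\<beta> > 0 \<and> fit_gap \<beta> = 0" for \<alpha> \<beta>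
    using that fit_gap_single_crossing[of \<alpha> \<beta>] fit_gap_single_crossing[of \<beta> \<alpha>]
    by (metis less_irrefl linorder_less_linear order_refl)
qed

lemma inverse_2lam_less: "1 / (2 * lam) < \<delta> / (2 * \<kappa>)"
  using pos excess_pos by (simp add: field_simps)

text \<open>Beyond \<open>\<rho>\<close> the denominator \<open>s * q x\<close> of the equation for \<open>\<alpha>\<close> is positive, so there the sign of
  \<open>fit_gap\<close> compares the two sides of that equation.\<close>

lemma inverse_2lam_less_iff:
  assumes "\<rho> < \<delta> / (2 * \<kappa>)" "\<alpha> > 0" "fit_gap \<alpha> = 0"
  shows "1 / (2 * lam) < \<alpha> \<longleftrightarrow>
    1 / (2 * lam) \<le> \<rho> \<or>
    1 / (2 * lam) > \<rho> \<and>
    tanh (s / (2 * lam)) <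
      2 * s * (\<delta> * lam - \<kappa>) * lam / (\<delta> * (\<delta> * lam - \<kappa>) - 4 * (\<kappa> + \<delta> * \<mu>) * lam\<^sup>2)"
proof -
  let ?x = "1 / (2 * lam)"
  have x: "?x \<ge> 0" and ne: "\<rho> \<noteq> \<delta> / (2 * \<kappa>)" using pos assms(1) by auto
  note iff = fit_gap_sign(1)[OF ne assms(2,3) x]
  show ?thesis
  proof (cases "?x \<le> \<rho>")
    case True
    then show ?thesis using iff fit_gap_sign_outside(1)[OF ne x] inverse_2lam_less by auto
  next
    case False
    then have "s * q ?x > 0" using q_sign(2)[OF x] s_pos by simp
    then have "tanh (s * ?x) < alpha_rhs \<delta> \<kappa> lam \<mu> ?x \<longleftrightarrow> 0 < fit_gap ?x"
      unfolding alpha_rhs_def fit_gap_def by (simp only: pos_less_divide_eq) (auto simp: mult_ac)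
    then show ?thesis
      using False iff alpha_rhs_at_inverse_2lam[of \<delta> lam \<kappa> \<mu>] pos by simp
  qed
qed

text \<open>The curvature at \<open>\<alpha>\<close> of the fitted solution has the sign of \<open>q \<alpha> + \<kappa> = \<delta> * ((\<delta> * lam - \<kappa>) * \<alpha>\<^sup>2 - \<mu>)\<close>,
  so it is nonnegative iff \<open>\<alpha>\<close> is at least \<open>\<beta> = sqrt (\<mu> / (\<delta> * lam - \<kappa>))\<close>. By the sign rule for \<open>fit_gap\<close>
  this means \<open>0 \<le> fit_gap \<beta>\<close>, which simplifies because \<open>q \<beta> = - \<kappa>\<close>.\<close>

lemma curvature_threshold_iff:
  assumes "\<rho> \<noteq> \<delta> / (2 * \<kappa>)" "\<alpha> > 0" "fit_gap \<alpha> = 0"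
  shows "tanh (sqrt (2 * \<delta> * \<mu> / (\<delta> * lam - \<kappa>)))
      \<ge> sqrt (2 * \<delta> * \<mu> / (\<delta> * lam - \<kappa>)) - \<delta>\<^sup>2 / (\<kappa> * s) \<longleftrightarrow> q \<alpha> + \<kappa> \<ge> 0"
proof -
  define \<beta> where "\<beta> = sqrt (\<mu> / (\<delta> * lam - \<kappa>))"
  have \<beta>: "\<beta> \<ge> 0" "\<beta>\<^sup>2 = \<mu> / (\<delta> * lam - \<kappa>)" using pos excess_pos by (simp_all add: \<beta>_def)
  have "sqrt (2 * \<delta> * \<mu> / (\<delta> * lam - \<kappa>)) = s * \<beta>"
    unfolding \<beta>_def real_sqrt_mult[symmetric] by (simp add: mult_ac)
  moreover have "q \<beta> = - \<kappa>" using \<beta>(2) excess_pos by simp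
  then have "fit_gap \<beta> = \<delta> * (\<delta> - 2 * \<kappa> * \<beta>) + s * \<kappa> * tanh (s * \<beta>)"
    by (simp only: fit_gap_def)
  then have "fit_gap \<beta> = s * \<kappa> * (tanh (s * \<beta>) - (s * \<beta> - \<delta>\<^sup>2 / (\<kappa> * s)))"
  proof -
    have "s * \<kappa> * (\<delta>\<^sup>2 / (\<kappa> * s)) = \<delta>\<^sup>2" using pos by simp
    moreover have "s * \<kappa> * (s * \<beta>) = 2 * \<delta> * \<kappa> * \<beta>" using s_sq by (simp add: mult_ac)
    moreover have "s * \<kappa> * (t - (b - c)) = s * \<kappa> * t - s * \<kappa> * b + s * \<kappa> * c" for t b c
      by (simp add: algebra_simps)
    ultimately have "s * \<kappa> * (tanh (s * \<beta>) - (s * \<beta> - \<delta>\<^sup>2 / (\<kappa> * s)))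
        = s * \<kappa> * tanh (s * \<beta>) - 2 * \<delta> * \<kappa> * \<beta> + \<delta>\<^sup>2"
      by (simp only:)
    then show ?thesis
      using \<open>fit_gap \<beta> = _\<close> by (simp only:) (simp add: power2_eq_square algebra_simps)
  qed
  then have "tanh (s * \<beta>) \<ge> s * \<beta> - \<delta>\<^sup>2 / (\<kappa> * s) \<longleftrightarrow> 0 \<le> fit_gap \<beta>"
  proof -
    have "0 \<le> c * (t - b) \<longleftrightarrow> b \<le> t" if "c > 0" for c b t :: real
      using that by (simp add: zero_le_mult_iff)
    from this[OF mult_pos_pos[OF s_pos pos(2)]] show ?thesis
      by (simp only: \<open>fit_gap \<beta> = s * \<kappa> * _\<close>)
  qed
  moreover have "0 \<le> fit_gap \<beta> \<longleftrightarrow> \<beta> \<le> \<alpha>" by (rule fit_gap_sign(2)[OF assms \<beta>(1)])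
  moreover have "\<beta> \<le> \<alpha> \<longleftrightarrow> \<beta>\<^sup>2 \<le> \<alpha>\<^sup>2" using \<beta>(1) assms(2) by simp
  moreover have "\<beta>\<^sup>2 \<le> \<alpha>\<^sup>2 \<longleftrightarrow> q \<alpha> + \<kappa> \<ge> 0"
  proof -
    have "q \<alpha> + \<kappa> = \<delta> * ((\<delta> * lam - \<kappa>) * \<alpha>\<^sup>2 - \<mu>)" by (simp add: algebra_simps)
    then show ?thesis using \<beta>(2) pos excess_pos by (simp add: zero_le_mult_iff pos_divide_le_eq mult.commute)
  qed
  ultimately show ?thesis by simp
qed

end

section \<open>The fitted solution\<close>

locale fitted_data = payoff_data +
  fixes \<alpha> :: real
  assumes alpha_pos: "\<alpha> > 0" and fit: "fit_gap \<alpha> = 0"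
begin

abbreviation "A \<equiv> coeffA \<delta> \<kappa> lam \<mu> \<alpha>"
abbreviation "w \<equiv> u_inner \<delta> \<kappa> lam \<mu> \<alpha>"

definition "w' x = A * s * sinh (s * x) + 2 * \<kappa> / \<delta> * x"
definition "w'' x = A * (2 * \<delta>) * cosh (s * x) + 2 * \<kappa> / \<delta>"

lemma A_cosh: "A * cosh (s * \<alpha>) = q \<alpha> / \<delta>\<^sup>2"
  by (simp add: coeffA_def)

lemma A_sign: "A < 0 \<longleftrightarrow> \<alpha> < \<rho>" "A > 0 \<longleftrightarrow> \<rho> < \<alpha>"
proof -
  have "\<delta>\<^sup>2 * cosh (s * \<alpha>) > 0" using pos by simp
  then show "A < 0 \<longleftrightarrow> \<alpha> < \<rho>" "A > 0 \<longleftrightarrow> \<rho> < \<alpha>"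
    unfolding coeffA_def using q_sign[of \<alpha>] alpha_pos
    by (simp_all add: divide_less_0_iff zero_less_divide_iff del: mult_pos_pos)
qed

lemma value_match: "w \<alpha> = lam * \<alpha>\<^sup>2"
proof -
  have "w \<alpha> = q \<alpha> / \<delta>\<^sup>2 + \<kappa> / \<delta> * \<alpha>\<^sup>2 + (\<kappa> + \<delta> * \<mu>) / \<delta>\<^sup>2"
    by (simp only: u_inner_def A_cosh)
  then show ?thesis using pos by (simp add: field_simps power2_eq_square)
qed

lemma slope_match: "w' \<alpha> = 1"
proof -
  have "A * s * sinh (s * \<alpha>) = s * (A * cosh (s * \<alpha>)) * tanh (s * \<alpha>)"
    by (simp add: tanh_def)
  also have "\<dots> = (s * q \<alpha> * tanh (s * \<alpha>)) / \<delta>\<^sup>2" by (simp add: A_cosh)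
  also have "s * q \<alpha> * tanh (s * \<alpha>) = \<delta> * (\<delta> - 2 * \<kappa> * \<alpha>)" using fit by (simp add: fit_gap_def)
  finally have "w' \<alpha> = \<delta> * (\<delta> - 2 * \<kappa> * \<alpha>) / \<delta>\<^sup>2 + 2 * \<kappa> / \<delta> * \<alpha>" by (simp only: w'_def)
  then show ?thesis using pos by (simp add: field_simps power2_eq_square)
qed

sublocale even_core w w' w'' \<alpha>
proof
  show "(w has_real_derivative w' x) (at x)" for x
    unfolding u_inner_def[abs_def] w'_def using pos by (auto intro!: derivative_eq_intros)
  show "(w' has_real_derivative w'' x) (at x)" for x
    unfolding w'_def[abs_def] w''_def using pos
    by (auto intro!: derivative_eq_intros)
  show "continuous_on {-\<alpha>..\<alpha>} w''"
    unfolding w''_def[abs_def] by (intro continuous_intros)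
qed (use alpha_pos slope_match in \<open>simp_all add: u_inner_def w'_def\<close>)

lemma u_cand_eq: "u_cand \<delta> \<kappa> lam \<mu> \<alpha> = u"
  by (simp add: fun_eq_iff u_cand_def unit_slope_extension_def)

lemma ode: "1 / 2 * w'' x - \<delta> * w x + running_payoff \<kappa> \<mu> x = 0"
  using pos unfolding w''_def u_inner_def running_payoff_def by (simp add: field_simps power2_eq_square)

text \<open>The excess \<open>w - g\<close> has derivative \<open>A * s * sinh (s * x) - 2 * (lam - \<kappa> / \<delta>) * x\<close>. For \<open>A \<le> 0\<close> this is
  visibly negative. For \<open>A > 0\<close> the slope \<open>sinh (s * x) / x\<close> is at most its value at \<open>\<alpha>\<close>, so that the
  derivative is at most \<open>x / \<alpha>\<close> times its value \<open>1 - 2 * lam * \<alpha> < 0\<close> at \<open>\<alpha>\<close>.\<close>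

lemma excess_decreasing:
  assumes "1 < 2 * lam * \<alpha>" "0 < x" "x \<le> \<alpha>"
  shows "w' x < 2 * lam * x"
proof -
  have *: "A * s * sinh (s * x) * \<alpha> < (2 * lam - 2 * \<kappa> / \<delta>) * x * \<alpha>"
  proof (cases "A > 0")
    case True
    have "sinh (s * x) * (s * \<alpha>) \<le> sinh (s * \<alpha>) * (s * x)"
      using assms s_pos by (intro sinh_slope_from_0_mono) auto
    then have "A * (sinh (s * x) * (s * \<alpha>)) \<le> A * (sinh (s * \<alpha>) * (s * x))"
      using True by (intro mult_left_mono) auto
    also have "\<dots> = (w' \<alpha> - 2 * \<kappa> / \<delta> * \<alpha>) * x" by (simp add: w'_def)
    also have "\<dots> < (2 * lam * \<alpha> - 2 * \<kappa> / \<delta> * \<alpha>) * x"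
      using assms slope_match by (intro mult_strict_right_mono) auto
    finally show ?thesis by (simp add: algebra_simps)
  next
    case False
    have "2 * lam - 2 * \<kappa> / \<delta> > 0" using pos excess_pos by (simp add: field_simps)
    then have "(2 * lam - 2 * \<kappa> / \<delta>) * x * \<alpha> > 0" using assms alpha_pos by simp
    moreover have "A * (s * sinh (s * x) * \<alpha>) \<le> 0"
      using False s_pos assms alpha_pos by (intro mult_nonpos_nonneg) auto
    ultimately show ?thesis by (simp add: mult_ac)
  qed
  then have "A * s * sinh (s * x) < (2 * lam - 2 * \<kappa> / \<delta>) * x" using alpha_pos by simp
  then show ?thesis by (simp add: w'_def algebra_simps)
qed

lemma above_terminal_payoff:
  assumes "1 < 2 * lam * \<alpha>" "\<bar>x\<bar> < \<alpha>"
  shows "lam * x\<^sup>2 < w x"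
proof -
  have "w \<alpha> - lam * \<alpha>\<^sup>2 < w \<bar>x\<bar> - lam * \<bar>x\<bar>\<^sup>2"
  proof (rule DERIV_neg_imp_decreasing_open[OF assms(2)])
    fix y assume y: "\<bar>x\<bar> < y" "y < \<alpha>"
    have "((\<lambda>y. w y - lam * y\<^sup>2) has_real_derivative w' y - 2 * lam * y) (at y)"
      by (auto intro!: derivative_eq_intros deriv1)
    moreover have "w' y - 2 * lam * y < 0" using excess_decreasing[of y] assms(1) y by simp
    ultimately show "\<exists>d. ((\<lambda>y. w y - lam * y\<^sup>2) has_real_derivative d) (at y) \<and> d < 0" by blast
  next
    show "continuous_on {\<bar>x\<bar>..\<alpha>} (\<lambda>y. w y - lam * y\<^sup>2)"
      unfolding u_inner_def[abs_def] by (intro continuous_intros)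
  qed
  then show ?thesis using value_match even[of x] by (auto simp: abs_if split: if_splits)
qed

text \<open>Positive curvature makes \<open>w'\<close> increase strictly from \<open>w' 0 = 0\<close> to \<open>w' \<alpha> = 1\<close>; the negative half
  follows because \<open>w'\<close> is odd.\<close>

lemma core_slope_less_1:
  assumes curv: "\<And>y. 0 < y \<Longrightarrow> y < \<alpha> \<Longrightarrow> 0 < w'' y" and x: "\<bar>x\<bar> < \<alpha>"
  shows "\<bar>w' x\<bar> < 1"
proof -
  have incr: "w' y < w' z" if "0 \<le> y" "y < z" "z \<le> \<alpha>" for y z
  proof (rule DERIV_pos_imp_increasing_open[OF that(2)])
    show "\<exists>d. (w' has_real_derivative d) (at t) \<and> 0 < d" if "y < t" "t < z" for t
      using deriv2 curv[of t] that \<open>0 \<le> y\<close> \<open>z \<le> \<alpha>\<close> by force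
  next
    show "continuous_on {y..z} w'"
      unfolding w'_def[abs_def] by (intro continuous_intros)
  qed
  have "w' \<bar>x\<bar> < 1" using incr[of "\<bar>x\<bar>" \<alpha>] x slope_match by simp
  moreover have "0 \<le> w' \<bar>x\<bar>"
    using incr[of 0 "\<bar>x\<bar>"] x by (cases "x = 0") (auto simp: w'_def)
  ultimately show ?thesis using odd[of x] by (auto simp: abs_if split: if_splits)
qed

lemma is_candidate_u_cand:
  assumes "1 < 2 * lam * \<alpha>" and "\<And>x. 0 < x \<Longrightarrow> x < \<alpha> \<Longrightarrow> 0 < w'' x"
  shows "is_candidate \<delta> (running_payoff \<kappa> \<mu>) (terminal_payoff lam) (u_cand \<delta> \<kappa> lam \<mu> \<alpha>)"
proof -
  have "candidate_wrt \<delta> (running_payoff \<kappa> \<mu>) (terminal_payoff lam) {} u"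
    using core_slope_less_1[OF assms(2)] above_terminal_payoff[OF assms(1)] assms(1)
      value_match pos ode by (intro candidate_u) auto
  then show ?thesis unfolding is_candidate_def u_cand_eq by blast
qed

lemma w''_at_alpha: "w'' \<alpha> = 2 * (q \<alpha> + \<kappa>) / \<delta>"
proof -
  have "w'' \<alpha> = 2 * \<delta> * (A * cosh (s * \<alpha>)) + 2 * \<kappa> / \<delta>" by (simp add: w''_def)
  also have "\<dots> = 2 * \<delta> * (q \<alpha> / \<delta>\<^sup>2) + 2 * \<kappa> / \<delta>" by (simp only: A_cosh)
  also have "2 * \<delta> * (c / \<delta>\<^sup>2) + 2 * \<kappa> / \<delta> = 2 * (c + \<kappa>) / \<delta>" for c
    using pos by (simp add: field_simps power2_eq_square)
  finally show ?thesis .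
qed

text \<open>Negative curvature at \<open>\<alpha>\<close> makes \<open>w'\<close> larger than \<open>w' \<alpha> = 1\<close> on a left neighbourhood of \<open>\<alpha>\<close>. This is an
  infinite set, so it has a point outside any finite exceptional set, and the bound on the derivative
  fails there.\<close>

lemma candidate_imp_curvature_nonneg:
  assumes "is_candidate \<delta> h g u"
  shows "w'' \<alpha> \<ge> 0"
proof (rule ccontr)
  assume "\<not> w'' \<alpha> \<ge> 0"
  then obtain d where d: "d > 0" "\<And>h. 0 < h \<Longrightarrow> h < d \<Longrightarrow> w' \<alpha> < w' (\<alpha> - h)"
    using DERIV_neg_dec_left[OF deriv2[of \<alpha>]] by auto
  \<comment> \<open>Capping at \<open>\<alpha>\<close> keeps the neighbourhood inside \<open>(0, \<alpha>)\<close>, where \<open>u\<close> coincides with \<open>w\<close>.\<close>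
  define e where "e = min d \<alpha>"
  obtain B where B: "finite B" "\<And>x. x \<notin> B \<Longrightarrow> \<bar>deriv u x\<bar> \<le> 1"
    using assms by (auto simp: is_candidate_def candidate_wrt_def)
  have "infinite {\<alpha> - e<..<\<alpha>}"
    using d(1) alpha_pos by (intro infinite_Ioo) (auto simp: e_def)
  then obtain x where x: "x \<in> {\<alpha> - e<..<\<alpha>}" "x \<notin> B"
    using B(1) by (meson finite_subset subsetI)
  then have "0 < x" "x < \<alpha>" by (auto simp: e_def)
  then have "deriv u x = w' x" by (simp add: deriv_u)
  moreover have "\<alpha> - x < d" using x by (auto simp: e_def)
  then have "1 < w' x" using d(2)[of "\<alpha> - x"] \<open>x < \<alpha>\<close> slope_match by simp
  ultimately show False using B(2)[OF x(2)] by simp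
qed

text \<open>For \<open>A < 0\<close> the second derivative of the core decreases on \<open>[0, \<alpha>]\<close>, so its sign at \<open>\<alpha>\<close> controls the
  whole interval.\<close>

lemma is_candidate_iff_curvature_nonneg:
  assumes "A < 0" "1 < 2 * lam * \<alpha>"
  shows "is_candidate \<delta> (running_payoff \<kappa> \<mu>) (terminal_payoff lam) (u_cand \<delta> \<kappa> lam \<mu> \<alpha>)
    \<longleftrightarrow> w'' \<alpha> \<ge> 0"
proof
  assume "w'' \<alpha> \<ge> 0"
  have "0 < w'' x" if "0 < x" "x < \<alpha>" for x
  proof -
    have "cosh (s * x) < cosh (s * \<alpha>)"
      using that s_pos by (simp add: cosh_real_nonneg_less_iff)
    moreover have "A * (2 * \<delta>) < 0" using assms(1) pos by (simp add: mult_neg_pos)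
    ultimately have "A * (2 * \<delta>) * cosh (s * \<alpha>) < A * (2 * \<delta>) * cosh (s * x)"
      by (rule mult_strict_left_mono_neg)
    then show ?thesis using \<open>w'' \<alpha> \<ge> 0\<close> unfolding w''_def by linarith
  qed
  then show "is_candidate \<delta> (running_payoff \<kappa> \<mu>) (terminal_payoff lam) (u_cand \<delta> \<kappa> lam \<mu> \<alpha>)"
    by (rule is_candidate_u_cand[OF assms(2)])
qed (use candidate_imp_curvature_nonneg u_cand_eq in simp)

lemma is_candidate_if_A_pos:
  assumes "A > 0" "1 < 2 * lam * \<alpha>"
  shows "is_candidate \<delta> (running_payoff \<kappa> \<mu>) (terminal_payoff lam) (u_cand \<delta> \<kappa> lam \<mu> \<alpha>)"
  using assms(1) pos
  by (intro is_candidate_u_cand[OF assms(2)]) (simp add: w''_def add_pos_pos)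

end


section \<open>The root, its location and the candidates\<close>

theorem proposition4:
  fixes \<delta> \<kappa> lam \<mu> :: real
  assumes "\<delta> > 0" and "\<kappa> > 0" and "lam > 0" and "\<mu> \<ge> 0"
    and "\<delta> * lam - \<kappa> > 0"
    and "rho \<delta> \<kappa> lam \<mu> \<noteq> \<delta> / (2 * \<kappa>)"
  shows "(\<exists>!\<alpha>. \<alpha> > 0 \<and> alpha_eq \<delta> \<kappa> lam \<mu> \<alpha>) \<and>
    (\<forall>\<alpha>. \<alpha> > 0 \<and> alpha_eq \<delta> \<kappa> lam \<mu> \<alpha> \<longrightarrow>
      (\<delta> / (2 * \<kappa>) < rho \<delta> \<kappa> lam \<mu> \<longrightarrow>
         1 / (2 * lam) < \<delta> / (2 * \<kappa>) \<and> \<delta> / (2 * \<kappa>) < \<alpha> \<and> \<alpha> < rho \<delta> \<kappa> lam \<mu>) \<and>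
      (rho \<delta> \<kappa> lam \<mu> < \<delta> / (2 * \<kappa>) \<longrightarrow>
         rho \<delta> \<kappa> lam \<mu> < \<alpha> \<and> \<alpha> < \<delta> / (2 * \<kappa>)) \<and>
      (\<delta> / (2 * \<kappa>) < rho \<delta> \<kappa> lam \<mu> \<longrightarrow>
         coeffA \<delta> \<kappa> lam \<mu> \<alpha> < 0 \<and>
         (is_candidate \<delta> (running_payoff \<kappa> \<mu>) (terminal_payoff lam) (u_cand \<delta> \<kappa> lam \<mu> \<alpha>) \<longleftrightarrow>
          tanh (sqrt (2 * \<delta> * \<mu> / (\<delta> * lam - \<kappa>))) \<ge>
            sqrt (2 * \<delta> * \<mu> / (\<delta> * lam - \<kappa>)) - \<delta>\<^sup>2 / (\<kappa> * sqrt (2 * \<delta>)))) \<and>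
      (rho \<delta> \<kappa> lam \<mu> < \<delta> / (2 * \<kappa>) \<longrightarrow>
         coeffA \<delta> \<kappa> lam \<mu> \<alpha> > 0 \<and>
         (1 / (2 * lam) < \<alpha> \<longleftrightarrow>
          1 / (2 * lam) \<le> rho \<delta> \<kappa> lam \<mu> \<or>
          1 / (2 * lam) > rho \<delta> \<kappa> lam \<mu> \<and>
          tanh (sqrt (2 * \<delta>) / (2 * lam)) <
            2 * sqrt (2 * \<delta>) * (\<delta> * lam - \<kappa>) * lam /
              (\<delta> * (\<delta> * lam - \<kappa>) - 4 * (\<kappa> + \<delta> * \<mu>) * lam\<^sup>2)) \<and>
         (1 / (2 * lam) < \<alpha> \<longrightarrow>
          is_candidate \<delta> (running_payoff \<kappa> \<mu>) (terminal_payoff lam) (u_cand \<delta> \<kappa> lam \<mu> \<alpha>))))"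
proof -
  interpret payoff_data \<delta> \<kappa> lam \<mu> by unfold_locales (use assms in auto)
  let "?unique \<and> (\<forall>\<alpha>. ?root \<alpha> \<longrightarrow> ?conclusion \<alpha>)" = ?thesis
  note ne = \<open>\<rho> \<noteq> \<delta> / (2 * \<kappa>)\<close>
  have ?unique
    using ex1_fit_gap_zero[OF ne] alpha_eq_iff[OF _ ne] by metis
  moreover have "?conclusion \<alpha>" if \<alpha>: "?root \<alpha>" for \<alpha>
  proof -
    have fit: "fit_gap \<alpha> = 0" and \<alpha>_pos: "\<alpha> > 0" using alpha_eq_iff[OF _ ne] \<alpha> by auto
    interpret fitted_data \<delta> \<kappa> lam \<mu> \<alpha> by unfold_locales (use \<alpha>_pos fit in auto)
    note outside = fit_gap_sign_outside[OF ne, of \<alpha>]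
    have steep: "1 / (2 * lam) < \<alpha> \<longleftrightarrow> 1 < 2 * lam * \<alpha>" using pos by (simp add: field_simps)
    have R1: "\<delta> / (2 * \<kappa>) < \<alpha>" "\<alpha> < \<rho>" if "\<delta> / (2 * \<kappa>) < \<rho>"
      using that outside \<alpha>_pos fit by force+
    have R2: "\<rho> < \<alpha>" "\<alpha> < \<delta> / (2 * \<kappa>)" if "\<rho> < \<delta> / (2 * \<kappa>)"
      using that outside \<alpha>_pos fit by force+
    have A_neg: "A < 0" if "\<delta> / (2 * \<kappa>) < \<rho>" using A_sign(1) R1[OF that] by blast
    have A_pos: "A > 0" if "\<rho> < \<delta> / (2 * \<kappa>)" using A_sign(2) R2[OF that] by blast
    have cand1: "is_candidate \<delta> (running_payoff \<kappa> \<mu>) (terminal_payoff lam) (u_cand \<delta> \<kappa> lam \<mu> \<alpha>)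
        \<longleftrightarrow> tanh (sqrt (2 * \<delta> * \<mu> / (\<delta> * lam - \<kappa>))) \<ge>
          sqrt (2 * \<delta> * \<mu> / (\<delta> * lam - \<kappa>)) - \<delta>\<^sup>2 / (\<kappa> * sqrt (2 * \<delta>))"
      if "\<delta> / (2 * \<kappa>) < \<rho>"
    proof -
      have "1 < 2 * lam * \<alpha>" using R1[OF that] inverse_2lam_less steep by linarith
      note is_candidate_iff_curvature_nonneg[OF A_neg[OF that] this]
      also have "w'' \<alpha> \<ge> 0 \<longleftrightarrow> q \<alpha> + \<kappa> \<ge> 0"
        unfolding w''_at_alpha using pos by (simp add: zero_le_divide_iff)
      also note curvature_threshold_iff[OF ne \<alpha>_pos fit, symmetric]
      finally show ?thesis .
    qed
    have cand2: "is_candidate \<delta> (running_payoff \<kappa> \<mu>) (terminal_payoff lam) (u_cand \<delta> \<kappa> lam \<mu> \<alpha>)"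
      if "\<rho> < \<delta> / (2 * \<kappa>)" "1 / (2 * lam) < \<alpha>"
      using is_candidate_if_A_pos[OF A_pos[OF that(1)]] steep that(2) by blast
    show ?thesis
      by (intro conjI impI inverse_2lam_less R1 R2 A_neg A_pos cand1 cand2
          inverse_2lam_less_iff[OF _ \<alpha>_pos fit])
  qed
  ultimately show ?thesis by blast
qed

end
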